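(* Let $(M^n,g)$ be a Strominger Kähler-like (SKL) manifold with $g$ not Kähler. If $n\geq 3$, then $g$ is never locally conformal Kähler.
   Context: $n$ is the complex dimension; $M$ need not be compact. For a Hermitian manifold $(M^n,g)$ with complex structure $J$, the Strominger (Bismut) connection $\nabla^s$ is the unique connection with $\nabla^s g=0$, $\nabla^s J=0$ whose torsion $T^s$ is totally skew-symmetric (i.e. $g(T^s(x,y),z)$ is a $3$-form). $(M,g)$ is Strominger Kähler-like (SKL) if the curvature tensor $R^s$ of $\nabla^s$ has all the symmetries of the curvature of a Kähler manifold: $R^s(x,y,z,w)+R^s(y,z,x,w)+R^s(z,x,y,w)=0$ and $R^s(x,y,z,w)=R^s(Jx,Jy,z,w)=R^s(x,y,Jz,Jw)$ for all real tangent vectors $x,y,z,w$. A Hermitian metric $g$ is locally conformal Kähler if every point has a neighborhood $U$ and a smooth real function $u$ on $U$ such that $e^{2u}g|_U$ is Kähler. *)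

theory Defs
  imports "HOL-Analysis.Analysis"
begin

(* Geometry of a complex manifold of complex dimension CARD('n), done in holomorphic charts.
   In a chart every tangent space is complex^'n, regarded as a real vector space, and the
   complex structure J is multiplication by the imaginary unit.  A tensor field (or a
   connection) is a family of local expressions, one for each chart of the atlas, that obeys
   the usual transformation law under change of chart.  The value of a local expression
   outside the image of its chart is irrelevant. *)


section \<open>Calculus on open subsets of Euclidean spaces\<close>

primrec Ck_on :: "nat \<Rightarrow> ('a::euclidean_space \<Rightarrow> 'b::real_normed_vector) \<Rightarrow> 'a set \<Rightarrow> bool" where
  "Ck_on 0 = (\<lambda>f S. continuous_on S f)"
| "Ck_on (Suc k) = (\<lambda>f S. (\<forall>z\<in>S. f differentiable (at z)) \<and>
      (\<forall>v. Ck_on k (\<lambda>z. frechet_derivative f (at z) v) S))"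

definition smooth_on :: "'a::euclidean_space set \<Rightarrow> ('a \<Rightarrow> 'b::real_normed_vector) \<Rightarrow> bool" where
  "smooth_on S f \<longleftrightarrow> (\<forall>k. Ck_on k f S)"

definition J :: "complex^'n \<Rightarrow> complex^'n" where
  "J v = \<i> *s v"

text \<open>Holomorphy in several variables: the real derivative exists and is complex linear.\<close>

definition holomorphic_map_on :: "(complex^'n) set \<Rightarrow> (complex^'n \<Rightarrow> complex^'m) \<Rightarrow> bool" where
  "holomorphic_map_on S f \<longleftrightarrow> (\<forall>z\<in>S. f differentiable (at z) \<and>
      (\<forall>v. frechet_derivative f (at z) (J v) = J (frechet_derivative f (at z) v)))"


section \<open>Complex manifolds\<close>

type_synonym ('a, 'n) chart = "'a set \<times> ('a \<Rightarrow> (complex, 'n) vec)"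

definition is_chart :: "'a topology \<Rightarrow> ('a, 'n::finite) chart \<Rightarrow> bool" where
  "is_chart M c \<longleftrightarrow> openin M (fst c) \<and> open (snd c ` fst c) \<and>
      homeomorphic_map (subtopology M (fst c)) (top_of_set (snd c ` fst c)) (snd c)"

definition transition :: "('a, 'n::finite) chart \<Rightarrow> ('a, 'n) chart \<Rightarrow> complex^'n \<Rightarrow> complex^'n" where
  "transition c d = snd d \<circ> inv_into (fst c) (snd c)"

definition complex_manifold :: "'a topology \<Rightarrow> ('a, 'n::finite) chart set \<Rightarrow> bool" where
  "complex_manifold M A \<longleftrightarrow>
      Hausdorff_space M \<and> second_countable M \<and>
      (\<forall>c\<in>A. is_chart M c) \<and> (\<Union>c\<in>A. fst c) = topspace M \<and>
      (\<forall>c\<in>A. \<forall>d\<in>A. holomorphic_map_on (snd c ` (fst c \<inter> fst d)) (transition c d))"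


section \<open>Hermitian and Kaehler metrics\<close>

text \<open>\<^term>\<open>g c z x y\<close> is the value of the metric on the tangent vectors with components
  \<^term>\<open>x\<close> and \<^term>\<open>y\<close> at the point with coordinates \<^term>\<open>z\<close> in the chart \<^term>\<open>c\<close>.\<close>

type_synonym ('a, 'n) metric =
  "('a, 'n) chart \<Rightarrow> (complex, 'n) vec \<Rightarrow> (complex, 'n) vec \<Rightarrow> (complex, 'n) vec \<Rightarrow> real"

definition hermitian_metric_on ::
  "('a, 'n::finite) chart set \<Rightarrow> 'a set \<Rightarrow> ('a, 'n) metric \<Rightarrow> bool" where
  "hermitian_metric_on A U g \<longleftrightarrow>
     (\<forall>c\<in>A.
        (\<forall>x y. smooth_on (snd c ` (fst c \<inter> U)) (\<lambda>z. g c z x y)) \<and>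
        (\<forall>z \<in> snd c ` (fst c \<inter> U).
           bilinear (g c z) \<and>
           (\<forall>x y. g c z x y = g c z y x) \<and>
           (\<forall>x. x \<noteq> 0 \<longrightarrow> g c z x x > 0) \<and>
           (\<forall>x y. g c z (J x) (J y) = g c z x y))) \<and>
     (\<forall>c\<in>A. \<forall>d\<in>A. \<forall>z \<in> snd c ` (fst c \<inter> fst d \<inter> U). \<forall>x y.
        g c z x y = g d (transition c d z)
          (frechet_derivative (transition c d) (at z) x)
          (frechet_derivative (transition c d) (at z) y))"

definition kaehler_form :: "('v \<Rightarrow> complex^'n \<Rightarrow> complex^'n \<Rightarrow> real) \<Rightarrow> 'v \<Rightarrow>
    complex^'n \<Rightarrow> complex^'n \<Rightarrow> real" where
  "kaehler_form h z x y = h z (J x) y"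

text \<open>The exterior derivative of a 2-form, evaluated on constant coordinate vector fields
  (whose Lie brackets vanish).\<close>

definition ext_deriv2 :: "(complex^'n \<Rightarrow> complex^'n \<Rightarrow> complex^'n \<Rightarrow> real) \<Rightarrow>
    complex^'n \<Rightarrow> complex^'n \<Rightarrow> complex^'n \<Rightarrow> complex^'n \<Rightarrow> real" where
  "ext_deriv2 w z x y v =
     frechet_derivative (\<lambda>p. w p y v) (at z) x +
     frechet_derivative (\<lambda>p. w p v x) (at z) y +
     frechet_derivative (\<lambda>p. w p x y) (at z) v"

definition kaehler_metric_on ::
  "('a, 'n::finite) chart set \<Rightarrow> 'a set \<Rightarrow> ('a, 'n) metric \<Rightarrow> bool" where
  "kaehler_metric_on A U g \<longleftrightarrow> hermitian_metric_on A U g \<and>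
     (\<forall>c\<in>A. \<forall>z \<in> snd c ` (fst c \<inter> U). \<forall>x y v. ext_deriv2 (kaehler_form (g c)) z x y v = 0)"

definition smooth_function_on ::
  "('a, 'n::finite) chart set \<Rightarrow> 'a set \<Rightarrow> ('a \<Rightarrow> real) \<Rightarrow> bool" where
  "smooth_function_on A U u \<longleftrightarrow>
     (\<forall>c\<in>A. smooth_on (snd c ` (fst c \<inter> U)) (u \<circ> inv_into (fst c) (snd c)))"

definition conformal_change ::
  "('a \<Rightarrow> real) \<Rightarrow> ('a, 'n::finite) metric \<Rightarrow> ('a, 'n) metric" where
  "conformal_change u g = (\<lambda>c z x y. exp (2 * u (inv_into (fst c) (snd c) z)) * g c z x y)"

definition locally_conformal_kaehler ::
  "'a topology \<Rightarrow> ('a, 'n::finite) chart set \<Rightarrow> ('a, 'n) metric \<Rightarrow> bool" where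
  "locally_conformal_kaehler M A g \<longleftrightarrow>
     (\<forall>p \<in> topspace M. \<exists>U u. openin M U \<and> p \<in> U \<and> smooth_function_on A U u \<and>
        kaehler_metric_on A U (conformal_change u g))"


section \<open>Connections\<close>

text \<open>A connection is given in the chart \<^term>\<open>c\<close> by its Christoffel symbol \<^term>\<open>\<Gamma> c\<close>: the
  covariant derivative of \<^term>\<open>Y\<close> along \<^term>\<open>X\<close> is \<^term>\<open>covariant_derivative (\<Gamma> c) X Y\<close>
  below.  The inhomogeneous transformation law says that this vector field does not depend on
  the chart.\<close>

type_synonym ('a, 'n) connection =
  "('a, 'n) chart \<Rightarrow> (complex, 'n) vec \<Rightarrow> (complex, 'n) vec \<Rightarrow> (complex, 'n) vec \<Rightarrow> (complex, 'n) vec"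

definition is_connection :: "('a, 'n::finite) chart set \<Rightarrow> ('a, 'n) connection \<Rightarrow> bool" where
  "is_connection A \<Gamma> \<longleftrightarrow>
     (\<forall>c\<in>A.
        (\<forall>x y. smooth_on (snd c ` fst c) (\<lambda>z. \<Gamma> c z x y)) \<and>
        (\<forall>z \<in> snd c ` fst c. bilinear (\<Gamma> c z))) \<and>
     (\<forall>c\<in>A. \<forall>d\<in>A. \<forall>z \<in> snd c ` (fst c \<inter> fst d). \<forall>x y.
        frechet_derivative (transition c d) (at z) (\<Gamma> c z x y) =
          frechet_derivative (\<lambda>p. frechet_derivative (transition c d) (at p) y) (at z) x +
          \<Gamma> d (transition c d z)
            (frechet_derivative (transition c d) (at z) x)
            (frechet_derivative (transition c d) (at z) y))"

definition covariant_derivative ::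
  "(complex^'n \<Rightarrow> complex^'n \<Rightarrow> complex^'n \<Rightarrow> complex^'n) \<Rightarrow>
   (complex^'n \<Rightarrow> complex^'n) \<Rightarrow> (complex^'n \<Rightarrow> complex^'n) \<Rightarrow> complex^'n \<Rightarrow> complex^'n" where
  "covariant_derivative G X Y z = frechet_derivative Y (at z) (X z) + G z (X z) (Y z)"

text \<open>The tensors below are evaluated on vectors \<^term>\<open>x\<close>, \<^term>\<open>y\<close>, \<^term>\<open>v\<close> at
  \<^term>\<open>z\<close> by extending these to constant coordinate vector fields; Lie brackets of such fields
  vanish.\<close>

definition torsion ::
  "(complex^'n \<Rightarrow> complex^'n \<Rightarrow> complex^'n \<Rightarrow> complex^'n) \<Rightarrow>
   complex^'n \<Rightarrow> complex^'n \<Rightarrow> complex^'n \<Rightarrow> complex^'n" where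
  "torsion G z x y =
     covariant_derivative G (\<lambda>_. x) (\<lambda>_. y) z - covariant_derivative G (\<lambda>_. y) (\<lambda>_. x) z"

definition curvature ::
  "(complex^'n \<Rightarrow> complex^'n \<Rightarrow> complex^'n \<Rightarrow> complex^'n) \<Rightarrow>
   complex^'n \<Rightarrow> complex^'n \<Rightarrow> complex^'n \<Rightarrow> complex^'n \<Rightarrow> complex^'n" where
  "curvature G z x y v =
     covariant_derivative G (\<lambda>_. x) (covariant_derivative G (\<lambda>_. y) (\<lambda>_. v)) z -
     covariant_derivative G (\<lambda>_. y) (covariant_derivative G (\<lambda>_. x) (\<lambda>_. v)) z"

definition nabla_metric ::
  "(complex^'n \<Rightarrow> complex^'n \<Rightarrow> complex^'n \<Rightarrow> complex^'n) \<Rightarrow>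
   (complex^'n \<Rightarrow> complex^'n \<Rightarrow> complex^'n \<Rightarrow> real) \<Rightarrow>
   complex^'n \<Rightarrow> complex^'n \<Rightarrow> complex^'n \<Rightarrow> complex^'n \<Rightarrow> real" where
  "nabla_metric G h z x y v =
     frechet_derivative (\<lambda>p. h p y v) (at z) x -
     h z (covariant_derivative G (\<lambda>_. x) (\<lambda>_. y) z) v -
     h z y (covariant_derivative G (\<lambda>_. x) (\<lambda>_. v) z)"

definition nabla_J ::
  "(complex^'n \<Rightarrow> complex^'n \<Rightarrow> complex^'n \<Rightarrow> complex^'n) \<Rightarrow>
   complex^'n \<Rightarrow> complex^'n \<Rightarrow> complex^'n \<Rightarrow> complex^'n" where
  "nabla_J G z x y =
     covariant_derivative G (\<lambda>_. x) (\<lambda>_. J y) z - J (covariant_derivative G (\<lambda>_. x) (\<lambda>_. y) z)"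


section \<open>The Strominger connection\<close>

definition totally_skew ::
  "(complex^'n \<Rightarrow> complex^'n \<Rightarrow> complex^'n \<Rightarrow> real) \<Rightarrow> bool" where
  "totally_skew t \<longleftrightarrow> (\<forall>x y v. t x y v = - t y x v \<and> t x y v = - t x v y)"

definition strominger_connection ::
  "('a, 'n::finite) chart set \<Rightarrow> ('a, 'n) metric \<Rightarrow> ('a, 'n) connection \<Rightarrow> bool" where
  "strominger_connection A g \<Gamma> \<longleftrightarrow> is_connection A \<Gamma> \<and>
     (\<forall>c\<in>A. \<forall>z \<in> snd c ` fst c.
        (\<forall>x y v. nabla_metric (\<Gamma> c) (g c) z x y v = 0) \<and>
        (\<forall>x y. nabla_J (\<Gamma> c) z x y = 0) \<and>
        totally_skew (\<lambda>x y v. g c z (torsion (\<Gamma> c) z x y) v))"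

definition kaehler_like ::
  "(complex^'n \<Rightarrow> complex^'n \<Rightarrow> complex^'n \<Rightarrow> complex^'n \<Rightarrow> real) \<Rightarrow> bool" where
  "kaehler_like R \<longleftrightarrow> (\<forall>x y v w.
     R x y v w + R y v x w + R v x y w = 0 \<and>
     R x y v w = R (J x) (J y) v w \<and>
     R x y v w = R x y (J v) (J w))"

text \<open>Every Hermitian metric has exactly one Strominger connection; uniqueness (on chart
  images, where it is meant) is the lemma \<open>strominger_connection_unique\<close> below.\<close>

definition strominger_kaehler_like ::
  "('a, 'n::finite) chart set \<Rightarrow> ('a, 'n) metric \<Rightarrow> bool" where
  "strominger_kaehler_like A g \<longleftrightarrow>
     (\<exists>\<Gamma>. strominger_connection A g \<Gamma> \<and>
       (\<forall>c\<in>A. \<forall>z \<in> snd c ` fst c.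
          kaehler_like (\<lambda>x y v w. g c z (curvature (\<Gamma> c) z x y v) w)))"

lemma skew_J_zero:
  fixes B :: "complex^'n \<Rightarrow> complex^'n \<Rightarrow> complex^'n \<Rightarrow> real"
  assumes skew: "\<And>x y v. B x y v = - B x v y"
    and tors: "\<And>x y v. B x y v - B y x v = - (B x v y - B v x y)"
    and JB: "\<And>x y v. B x (J y) v = - B x y (J v)"
    and neg: "\<And>x y v. B (- x) y v = - B x y v"
  shows "B x y v = 0"
proof -
  have s12: "B x y v = - B y x v" for x y v
    using skew[of x y v] skew[of y x v] skew[of v x y] tors[of x y v] tors[of y x v] tors[of v x y]
    by linarith
  have J1: "B (J x) y v = 0" for x y v
    using JB[of y x v] JB[of v y x] JB[of x v y] s12[of "J x" y v] skew[of y x "J v"]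
      s12[of y "J v" x] s12[of y x "J v"] s12[of x y "J v"] skew[of x y "J v"]
      s12[of x "J v" y] s12[of "J x" v y] skew[of v y "J x"] skew[of "J x" y v]
      s12[of v "J x" y] s12[of v "J y" x] skew[of v "J y" x] skew[of x v "J y"]
      s12[of x v "J y"] skew[of "J v" x y] s12[of "J v" x y]  JB[of x y v] skew[of x "J y" v]
    by linarith
  have "J (J x) = - x" by (simp add: J_def vec_eq_iff flip: mult.assoc)
  then show ?thesis using J1[of "J x" y v] neg[of x y v] by simp
qed

lemma strominger_connectionD:
  assumes S: "strominger_connection A g \<Gamma>" and c: "c \<in> A" "z \<in> snd c ` fst c"
  shows "bilinear (\<Gamma> c z)"
    and "nabla_metric (\<Gamma> c) (g c) z x y v = 0"
    and "nabla_J (\<Gamma> c) z x y = 0"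
    and "totally_skew (\<lambda>x y v. g c z (torsion (\<Gamma> c) z x y) v)"
proof -
  note D = S[unfolded strominger_connection_def is_connection_def]
  show "bilinear (\<Gamma> c z)"
    using D[THEN conjunct1, THEN conjunct1] c by blast
  note E = D[THEN conjunct2, rule_format, OF c]
  show "nabla_metric (\<Gamma> c) (g c) z x y v = 0" "nabla_J (\<Gamma> c) z x y = 0"
    "totally_skew (\<lambda>x y v. g c z (torsion (\<Gamma> c) z x y) v)"
    using E by auto
qed

lemma strominger_connection_unique:
  assumes g: "hermitian_metric_on A U g" and U: "\<And>c. c \<in> A \<Longrightarrow> fst c \<subseteq> U"
    and S: "strominger_connection A g \<Gamma>" "strominger_connection A g \<Gamma>'"
    and c: "c \<in> A" "z \<in> snd c ` fst c"
  shows "\<Gamma> c z = \<Gamma>' c z"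
proof (intro ext)
  fix x y
  have z: "z \<in> snd c ` (fst c \<inter> U)" using c U by blast
  note G = g[unfolded hermitian_metric_on_def, THEN conjunct1, rule_format, OF c(1), THEN conjunct2, rule_format, OF z]
  have bil: "bilinear (g c z)" and sym: "\<And>x y. g c z x y = g c z y x"
    and pos: "\<And>x. x \<noteq> 0 \<Longrightarrow> g c z x x > 0"
    and herm: "\<And>x y. g c z (J x) (J y) = g c z x y" using G by auto
  have JJ: "J (J v) = - v" for v :: "complex^'b" by (simp add: J_def vec_eq_iff flip: mult.assoc)
  have bilG: "bilinear (\<Gamma> c z)" "bilinear (\<Gamma>' c z)"
    using strominger_connectionD(1) S c by blast+
  define B where "B = (\<lambda>x y v. g c z (\<Gamma> c z x y - \<Gamma>' c z x y) v)"
  have Jg: "g c z (J a) b = - g c z a (J b)" for a b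
    using herm[of a "J b"] by (simp add: JJ bilinear_rneg[OF bil])
  have Jsub: "J (a - b) = J a - J b" for a b :: "complex^'b"
    by (simp add: J_def vec_eq_iff algebra_simps)
  have "B x y v = 0" for v
  proof (rule skew_J_zero)
    fix x y v
    have m: "nabla_metric (\<Gamma> c) (g c) z x y v = 0" "nabla_metric (\<Gamma>' c) (g c) z x y v = 0"
      using strominger_connectionD(2) S c by blast+
    then show "B x y v = - B x v y"
      unfolding B_def nabla_metric_def covariant_derivative_def
      by (simp add: bilinear_lsub[OF bil] sym[of y])
    have t: "totally_skew (\<lambda>x y v. g c z (torsion (\<Gamma> c) z x y) v)"
      "totally_skew (\<lambda>x y v. g c z (torsion (\<Gamma>' c) z x y) v)"
      using strominger_connectionD(4) S c by blast+
    have "g c z (torsion (\<Gamma> c) z x y) v = - g c z (torsion (\<Gamma> c) z x v) y"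
      "g c z (torsion (\<Gamma>' c) z x y) v = - g c z (torsion (\<Gamma>' c) z x v) y"
      using t unfolding totally_skew_def by blast+
    then show "B x y v - B y x v = - (B x v y - B v x y)"
      unfolding B_def torsion_def covariant_derivative_def
      by (simp add: bilinear_lsub[OF bil])
    have "nabla_J (\<Gamma> c) z x y = 0" "nabla_J (\<Gamma>' c) z x y = 0"
      using strominger_connectionD(3) S c by blast+
    then have "\<Gamma> c z x (J y) - \<Gamma>' c z x (J y) = J (\<Gamma> c z x y - \<Gamma>' c z x y)"
      unfolding nabla_J_def covariant_derivative_def by (simp add: Jsub)
    then show "B x (J y) v = - B x y (J v)" unfolding B_def by (simp add: Jg)
    show "B (- x) y v = - B x y v"
      unfolding B_def by (simp add: bilinear_lneg[OF bilG(1)] bilinear_lneg[OF bilG(2)]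
          bilinear_lsub[OF bil] bilinear_lneg[OF bil])
  qed
  then show "\<Gamma> c z x y = \<Gamma>' c z x y"
    using pos[of "\<Gamma> c z x y - \<Gamma>' c z x y"] unfolding B_def by force
qed

end

(* The contradiction is pointwise.  If g = exp (-2u) h with h Kaehler, then d omega = theta /\ omega
   with theta = -2 du, and the Strominger torsion is the 3-form alpha /\ omega with
   alpha = theta o J.  The first Bianchi identity of a metric connection with torsion, together
   with the Kaehler-like condition, gives
     cyc_{x,y,v} [(nabla_x alpha /\ omega)(y, v, w) + (alpha /\ omega)(tau(x, y), v, w)] = 0.
   Let a be dual to alpha.  Evaluating on (a, Ja, y, Jy) with y orthogonal to a and Ja kills
   (nabla_y alpha)(Jy); for n >= 3 there are two such orthogonal directions y, z, and evaluating on
   (y, Jy, z, Jz) then leaves |a|^2 |y|^2 |z|^2 = 0.  So theta = 0, i.e. d omega = 0. *)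

theory Submission
  imports Defs
begin

section \<open>Hermitian inner products\<close>

lemma J_J [simp]: "J (J v) = - v"
  by (simp add: J_def vec_eq_iff flip: mult.assoc)

lemma linear_J: "linear J"
  by (rule linearI) (simp_all add: J_def vec_eq_iff algebra_simps scaleR_conv_of_real)

lemmas J_simps = linear_add[OF linear_J] linear_diff[OF linear_J] linear_neg[OF linear_J]

text \<open>The pointwise content of \<open>hermitian_metric_on\<close>, isolated so that the linear
  algebra takes place in a single tangent space.\<close>

definition hermitian_inner :: "(complex^'n \<Rightarrow> complex^'n \<Rightarrow> real) \<Rightarrow> bool" where
  "hermitian_inner q \<longleftrightarrow> bilinear q \<and> (\<forall>x y. q x y = q y x) \<and>
     (\<forall>x. x \<noteq> 0 \<longrightarrow> q x x > 0) \<and> (\<forall>x y. q (J x) (J y) = q x y)"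

lemma hermitian_innerD:
  assumes "hermitian_inner q"
  shows "bilinear q" "q x y = q y x" "x \<noteq> 0 \<Longrightarrow> q x x > 0" "q (J x) (J y) = q x y"
    "q x (J y) = - q (J x) y"
proof -
  show *: "bilinear q" "q x y = q y x" "x \<noteq> 0 \<Longrightarrow> q x x > 0" "q (J x) (J y) = q x y" for x y
    using assms by (auto simp: hermitian_inner_def)
  show "q x (J y) = - q (J x) y"
    using *(4)[of x "J y"] by (simp add: bilinear_rneg[OF *(1)])
qed

lemma hermitian_inner_J_self:
  assumes "hermitian_inner q"
  shows "q x (J x) = 0" "q (J x) x = 0"
  using hermitian_innerD(5)[OF assms, of x x] hermitian_innerD(2)[OF assms, of x "J x"] by simp_all

text \<open>\<open>S x\<close> collects the Euclidean components of the functional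
  \<open>q x\<close>. It is injective because \<open>S x = 0\<close> forces
  \<open>q x x = 0\<close>, hence surjective by dimension; through it Euclidean duality and
  orthogonality carry over to \<open>q\<close>.\<close>

lemma hermitian_inner_gram:
  fixes q :: "complex^'n::finite \<Rightarrow> complex^'n \<Rightarrow> real"
  assumes "hermitian_inner q"
  shows "\<exists>S. linear S \<and> surj S \<and> (\<forall>x y. q x y = S x \<bullet> y)"
proof -
  note q = hermitian_innerD[OF assms]
  define S where "S x = (\<Sum>b\<in>Basis. q x b *\<^sub>R b)" for x
  have lin1: "linear (\<lambda>x. q x y)" and lin2: "linear (q x)" for x y
    using q(1) by (simp_all add: bilinear_def)
  have S: "q x y = S x \<bullet> y" for x y
  proof -
    have "q x y = q x (\<Sum>b\<in>Basis. (y \<bullet> b) *\<^sub>R b)" by (simp add: euclidean_representation)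
    also have "\<dots> = (\<Sum>b\<in>Basis. (y \<bullet> b) * q x b)"
      by (simp add: linear_sum[OF lin2] linear_cmul[OF lin2])
    finally show ?thesis by (simp add: S_def inner_sum_right inner_commute[of _ y] mult.commute)
  qed
  have linS: "linear S"
    unfolding S_def
    by (rule linearI)
      (simp_all add: linear_add[OF lin1] linear_cmul[OF lin1] scaleR_add_left sum.distrib scaleR_sum_right)
  have "inj S"
  proof (subst linear_injective_0[OF linS], intro allI impI)
    fix x assume "S x = 0"
    then show "x = 0" using S[of x x] q(3)[of x] by fastforce
  qed
  then show ?thesis using linear_injective_imp_surjective[OF linS] S linS by blast
qed

lemma hermitian_inner_riesz:
  fixes q :: "complex^'n::finite \<Rightarrow> complex^'n \<Rightarrow> real"
  assumes "hermitian_inner q" and "linear \<alpha>"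
  shows "\<exists>a. \<forall>x. \<alpha> x = q a x"
proof -
  obtain S where S: "surj S" "\<forall>x y. q x y = S x \<bullet> y"
    using hermitian_inner_gram[OF assms(1)] by blast
  \<comment> \<open>\<open>adjoint \<alpha> 1\<close> is the Euclidean dual vector of
    \<alpha>.\<close>
  obtain a where a: "S a = adjoint \<alpha> 1" using S(1) by (metis surjD)
  have "\<alpha> x = q a x" for x
    using adjoint_works[OF assms(2), of x 1] by (simp add: S(2) a inner_commute)
  then show ?thesis by blast
qed

text \<open>Being \<open>q\<close>-orthogonal to \<open>s\<close> is being Euclidean orthogonal to
  \<open>S s\<close>, so this is a count against the real dimension 2n.\<close>

lemma hermitian_inner_orthogonal_exists:
  fixes q :: "complex^'n::finite \<Rightarrow> complex^'n \<Rightarrow> real"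
  assumes "hermitian_inner q" and "finite F" and "card F < 2 * CARD('n)"
  obtains x where "x \<noteq> 0" "\<And>s. s \<in> F \<Longrightarrow> q s x = 0"
proof -
  obtain S where S: "\<forall>x y. q x y = S x \<bullet> y"
    using hermitian_inner_gram[OF assms(1)] by blast
  have "dim (S ` F) \<le> card (S ` F)" using assms(2) by (intro dim_le_card') auto
  also have "\<dots> \<le> card F" using assms(2) by (rule card_image_le)
  finally have "dim (S ` F) < DIM(complex^'n)" using assms(3) by simp
  from orthogonal_to_subspace_exists[OF this] obtain x
    where "x \<noteq> 0" "\<And>y. y \<in> span (S ` F) \<Longrightarrow> orthogonal x y" by blast
  then show ?thesis
    using that by (metis S image_eqI inner_commute orthogonal_def span_base)
qed

text \<open>Here the bound on n enters: the four real vectors \<open>a\<close>, \<open>J a\<close>,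
  \<open>y\<close>, \<open>J y\<close> cannot span, since 2n is at least 6.\<close>

lemma hermitian_inner_unitary_pair:
  fixes q :: "complex^'n::finite \<Rightarrow> complex^'n \<Rightarrow> real"
  assumes "hermitian_inner q" and n: "CARD('n) \<ge> 3"
  obtains y z where "y \<noteq> 0" "z \<noteq> 0" "q a y = 0" "q (J a) y = 0"
    "q a z = 0" "q (J a) z = 0" "q y z = 0" "q (J y) z = 0"
proof -
  have "card {a, J a} < 2 * CARD('n)"
    by (rule le_less_trans[OF card_insert_le_m1]) (use n in auto)
  then obtain y where y: "y \<noteq> 0" "\<And>s. s \<in> {a, J a} \<Longrightarrow> q s y = 0"
    using hermitian_inner_orthogonal_exists[OF assms(1), of "{a, J a}"] by blast
  have "card {a, J a, y, J y} \<le> 4" by (simp add: card_insert_if)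
  then have "card {a, J a, y, J y} < 2 * CARD('n)" using n by linarith
  then obtain z where z: "z \<noteq> 0" "\<And>s. s \<in> {a, J a, y, J y} \<Longrightarrow> q s z = 0"
    using hermitian_inner_orthogonal_exists[OF assms(1), of "{a, J a, y, J y}"] by blast
  show ?thesis using that[of y z] y z by simp
qed

section \<open>Algebra of the 3-form \<alpha> wedge \<omega> in one tangent space\<close>

text \<open>For skew \<omega> this is the wedge product of a 1-form and a 2-form, normalized without
  a factor.\<close>

definition wedge12 :: "('v \<Rightarrow> real) \<Rightarrow> ('v \<Rightarrow> 'v \<Rightarrow> real) \<Rightarrow> 'v \<Rightarrow> 'v \<Rightarrow> 'v \<Rightarrow> real" where
  "wedge12 \<alpha> \<omega> x y v = \<alpha> x * \<omega> y v + \<alpha> y * \<omega> v x + \<alpha> v * \<omega> x y"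

text \<open>\<open>B x\<close> stands for the covariant derivative of \<alpha> along
  \<open>x\<close> and \<tau> for the torsion; \<open>bianchi\<close> is what a vanishing cyclic
  curvature sum says once the torsion is \<alpha> wedge \<omega>.\<close>

lemma bianchi_wedge_imp_zero:
  fixes q :: "complex^'n::finite \<Rightarrow> complex^'n \<Rightarrow> real"
  defines "\<omega> \<equiv> \<lambda>x y. q (J x) y"
  assumes q: "hermitian_inner q" and n: "CARD('n) \<ge> 3" and \<alpha>: "linear \<alpha>"
    and \<tau>: "\<And>x y v. q (\<tau> x y) v = wedge12 \<alpha> \<omega> x y v"
    and bianchi: "\<And>x y v w. wedge12 (B x) \<omega> y v w + wedge12 (B y) \<omega> v x w + wedge12 (B v) \<omega> x y w
        + wedge12 \<alpha> \<omega> (\<tau> x y) v w + wedge12 \<alpha> \<omega> (\<tau> y v) x w + wedge12 \<alpha> \<omega> (\<tau> v x) y w = 0"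
  shows "\<alpha> = (\<lambda>_. 0)"
proof -
  note Q = hermitian_innerD[OF q]
  obtain a where a: "\<forall>x. \<alpha> x = q a x" using hermitian_inner_riesz[OF q \<alpha>] by blast
  obtain y z where yz: "y \<noteq> 0" "z \<noteq> 0" "q a y = 0" "q (J a) y = 0"
    "q a z = 0" "q (J a) z = 0" "q y z = 0" "q (J y) z = 0"
    by (rule hermitian_inner_unitary_pair[OF q n])
  have yz': "q y a = 0" "q z a = 0" "q z y = 0" "q (J y) a = 0" "q (J z) a = 0" "q (J z) y = 0"
    using yz(3-8) Q(2)[of y a] Q(2)[of z a] Q(2)[of z y] Q(2)[of "J a"] Q(2)[of "J y"]
      Q(5)[of y a] Q(5)[of z a] Q(5)[of z y] by simp_all
  \<comment> \<open>\<tau> enters only through its pairings with \<open>a\<close>,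
    \<open>J v\<close> and \<open>J w\<close>, which are again values of the 3-form. After this
    rewriting each instance of \<open>bianchi\<close> reduces to values of \<open>B\<close> and
    \<open>q\<close>, evaluated by the orthogonality relations.\<close>
  have WT: "wedge12 \<alpha> \<omega> (\<tau> x y) v w = wedge12 \<alpha> \<omega> x y a * q (J v) w
      + q a v * wedge12 \<alpha> \<omega> x y (J w) - q a w * wedge12 \<alpha> \<omega> x y (J v)" for x y v w
  proof -
    have "\<alpha> (\<tau> x y) = wedge12 \<alpha> \<omega> x y a"
      using \<tau>[of x y a] a[rule_format, of "\<tau> x y"] Q(2)[of a] by simp
    moreover have "\<omega> (\<tau> x y) v = - wedge12 \<alpha> \<omega> x y (J v)"
      using \<tau>[of x y "J v"] Q(5)[of "\<tau> x y" v] by (simp add: \<omega>_def)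
    moreover have "\<omega> w (\<tau> x y) = wedge12 \<alpha> \<omega> x y (J w)"
      using \<tau>[of x y "J w"] Q(2)[of "J w"] by (simp add: \<omega>_def)
    ultimately show ?thesis
      unfolding wedge12_def[of \<alpha> \<omega> "\<tau> x y" v w] by (simp add: a \<omega>_def)
  qed
  note W = bianchi[unfolded WT, unfolded wedge12_def \<omega>_def a[rule_format]]
  note S = Q(4) Q(5) hermitian_inner_J_self[OF q] J_simps bilinear_lneg[OF Q(1)]
    bilinear_rneg[OF Q(1)]
  show ?thesis
  proof (cases "a = 0")
    case True
    then show ?thesis using a bilinear_lzero[OF Q(1)] by (auto simp: fun_eq_iff)
  next
    case False
    note aa = Q(3)[OF False]
    \<comment> \<open>All torsion terms vanish on these four tuples. With P =
      \<open>(B a (J a) - B (J a) a) * q v v\<close>, X = \<open>B v (J v) * q a a\<close> and Y =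
      \<open>B (J v) v * q a a\<close>, the first two give X = -P and Y = P, and the difference of
      the last two gives 2(X - Y) + P = 0. Hence -3P = 0 and X = Y = 0.\<close>
    have B0: "B v (J v) = 0 \<and> B (J v) v = 0"
      if v: "v \<noteq> 0" "q a v = 0" "q (J a) v = 0" "q v a = 0" "q (J v) a = 0" for v
    proof -
      have "(B a (J a) - B (J a) a) * q v v + B v (J v) * q a a = 0"
        using W[of a "J a" v "J v"] by (simp add: S v(2-) algebra_simps)
      moreover have "- ((B a (J a) - B (J a) a) * q v v) + B (J v) v * q a a = 0"
        using W[of a "J a" "J v" v] by (simp add: S v(2-) algebra_simps)
      moreover have "(B v (J v) - B (J v) v) * q a a + B a (J a) * q v v = 0"
        using W[of v "J v" a "J a"] by (simp add: S v(2-) algebra_simps)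
      moreover have "- ((B v (J v) - B (J v) v) * q a a) + B (J a) a * q v v = 0"
        using W[of v "J v" "J a" a] by (simp add: S v(2-) algebra_simps)
      ultimately have "B v (J v) * q a a = 0" "B (J v) v * q a a = 0"
        unfolding left_diff_distrib by linarith+
      then show ?thesis using aa by simp
    qed
    \<comment> \<open>One torsion term survives: \<open>\<tau> y (J y)\<close> pairs with
      \<open>a\<close> to \<open>q a a * q y y\<close>, and \<open>\<omega> z (J z)\<close> is
      \<open>q z z\<close>.\<close>
    have "(B y (J y) - B (J y) y) * q z z + B z (J z) * q y y + q a a * (q y y * q z z) = 0"
      using W[of y "J y" z "J z"] by (simp add: S yz(3-8) yz' algebra_simps)
    then have "q a a * (q y y * q z z) = 0"
      using B0[of y] B0[of z] yz yz' by simp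
    then show ?thesis using aa Q(3)[of y] Q(3)[of z] yz(1,2) by simp
  qed
qed


text \<open>\<open>d\<omega>\<close> is the equation d\<omega> = \<theta> wedge \<omega>, with
  derivatives of the parallel form \<omega> expressed through \<open>G\<close>. At
  \<open>J x\<close>, \<open>J y\<close>, \<open>J v\<close> its left side is the cyclic sum of
  \<open>T (J x) (J y) v\<close>, which the Nijenhuis identity and skewness identify with
  \<open>T x y v\<close>; as \<omega> is J-invariant, the right side is the wedge of \<theta> o J
  with \<omega>.\<close>

lemma lck_torsion:
  fixes q :: "complex^'n::finite \<Rightarrow> complex^'n \<Rightarrow> real"
  defines "\<omega> \<equiv> \<lambda>x y. q (J x) y"
  assumes q: "hermitian_inner q"
    and GJ: "\<And>x y. G x (J y) = J (G x y)"
    and skew: "totally_skew (\<lambda>x y v. q (G x y - G y x) v)"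
    and d\<omega>: "\<And>x y v. (\<omega> (G x y) v + \<omega> y (G x v)) + (\<omega> (G y v) x + \<omega> v (G y x))
        + (\<omega> (G v x) y + \<omega> x (G v y)) = wedge12 \<theta> \<omega> x y v"
  shows "q (G x y - G y x) v = wedge12 (\<lambda>x. \<theta> (J x)) \<omega> x y v"
proof -
  note Q = hermitian_innerD[OF q]
  note L = bilinear_ladd[OF Q(1)] bilinear_lsub[OF Q(1)] bilinear_rsub[OF Q(1)]
    bilinear_lneg[OF Q(1)] bilinear_rneg[OF Q(1)]
  define T where "T x y v = q (G x y - G y x) v" for x y v
  have T: "T x y v = - T y x v" "T x y v = - T x v y" for x y v
    using skew unfolding totally_skew_def T_def by blast+
  \<comment> \<open>Vanishing of the Nijenhuis tensor: \<^term>\<open>T\<close> has no component of type (3,0).\<close>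
  have nij: "T x y v = T (J x) (J y) v + T (J x) y (J v) + T x (J y) (J v)"
    by (simp add: T_def GJ L Q(5) J_simps)
  have "T (J x) (J y) v + T (J y) (J v) x + T (J v) (J x) y = wedge12 \<theta> \<omega> (J x) (J y) (J v)"
    using d\<omega>[of "J x" "J y" "J v"] Q(2)[of "J y" "G (J x) v"] Q(2)[of "J v" "G (J y) x"]
      Q(2)[of "J x" "G (J v) y"]
    by (simp add: T_def \<omega>_def GJ L Q(4,5) J_simps)
  moreover have "T (J y) (J v) x = T x (J y) (J v)" "T (J v) (J x) y = T (J x) y (J v)"
    using T by metis+
  ultimately show ?thesis
    using nij by (simp add: T_def wedge12_def \<omega>_def Q(4,5) L J_simps)
qed

section \<open>Tensor calculus in a chart\<close>

text \<open>In a basis, \<open>h p (Y p)\<close> is a finite sum of products of differentiable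
  functions; linearity on the open set \<open>V\<close> makes this expansion valid near
  \<open>z\<close>.\<close>

lemma frechet_derivative_linear_apply:
  fixes h :: "'a::euclidean_space \<Rightarrow> 'b::euclidean_space \<Rightarrow> 'c::real_normed_vector"
  assumes V: "open V" "z \<in> V" and lin: "\<And>p. p \<in> V \<Longrightarrow> linear (h p)"
    and h: "\<And>b. (\<lambda>p. h p b) differentiable (at z)" and Y: "Y differentiable (at z)"
  shows "frechet_derivative (\<lambda>p. h p (Y p)) (at z) x =
    frechet_derivative (\<lambda>p. h p (Y z)) (at z) x + h z (frechet_derivative Y (at z) x)"
proof -
  define h' where "h' b = frechet_derivative (\<lambda>p. h p b) (at z)" for b
  define Y' where "Y' = frechet_derivative Y (at z)"
  have dh: "((\<lambda>p. h p b) has_derivative h' b) (at z)" for b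
    using h unfolding h'_def by (simp add: frechet_derivative_works)
  have dY: "(Y has_derivative Y') (at z)"
    using Y unfolding Y'_def by (simp add: frechet_derivative_works)
  have expand: "h p v = (\<Sum>b\<in>Basis. (v \<bullet> b) *\<^sub>R h p b)" if "p \<in> V" for p v
  proof -
    have "h p v = h p (\<Sum>b\<in>Basis. (v \<bullet> b) *\<^sub>R b)" by (simp add: euclidean_representation)
    then show ?thesis by (simp add: linear_sum[OF lin] linear_cmul[OF lin] that)
  qed
  \<comment> \<open>Applied both to \<open>Y\<close> and to the constant \<open>Y z\<close>;
    comparing the two eliminates the basis sum.\<close>
  have gen: "((\<lambda>p. h p (X p)) has_derivative
      (\<lambda>x. (\<Sum>b\<in>Basis. (X z \<bullet> b) *\<^sub>R h' b x) + h z (X' x))) (at z)"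
    if X: "(X has_derivative X') (at z)" for X X'
  proof (rule has_derivative_transform_within_open[OF _ V])
    show "((\<lambda>p. \<Sum>b\<in>Basis. (X p \<bullet> b) *\<^sub>R h p b) has_derivative
        (\<lambda>x. (\<Sum>b\<in>Basis. (X z \<bullet> b) *\<^sub>R h' b x) + h z (X' x))) (at z)"
      unfolding expand[OF V(2), of "X' _"] sum.distrib[symmetric]
      by (intro has_derivative_sum has_derivative_scaleR has_derivative_inner_left X dh)
  qed (simp add: expand)
  show ?thesis
    using frechet_derivative_at[OF gen[OF dY], THEN fun_cong, of x]
      frechet_derivative_at[OF gen[OF has_derivative_const[of "Y z"]], THEN fun_cong, of x]
      linear_0[OF lin[OF V(2)]]
    unfolding Y'_def by simp
qed

lemma covariant_derivative_const [simp]: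
  "covariant_derivative G (\<lambda>_. x) (\<lambda>_. y) = (\<lambda>p. G p x y)"
  by (simp add: fun_eq_iff covariant_derivative_def frechet_derivative_const)

lemma covariant_derivative_along_const:
  "covariant_derivative G (\<lambda>_. x) Y p = frechet_derivative Y (at p) x + G p x (Y p)"
  by (simp add: covariant_derivative_def)

lemma frechet_derivative_metric:
  assumes "nabla_metric G q z x a b = 0"
  shows "frechet_derivative (\<lambda>p. q p a b) (at z) x = q z (G z x a) b + q z a (G z x b)"
  using assms by (simp add: nabla_metric_def)

text \<open>Constant fields have vanishing brackets, so the cyclic sum of R(x,y)v equals that of
  nabla_x (nabla_y v - nabla_v y), and the inner difference is the torsion field. Since the metric
  is parallel, \<open>E x y v w\<close> is the pairing of nabla_x (T(y,v)) with
  \<open>w\<close>.\<close>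

lemma first_bianchi_torsion:
  fixes q :: "complex^'n::finite \<Rightarrow> complex^'n \<Rightarrow> complex^'n \<Rightarrow> real"
  assumes V: "open V" "z \<in> V" and q: "\<And>p. p \<in> V \<Longrightarrow> bilinear (q p)"
    and dq: "\<And>x y. (\<lambda>p. q p x y) differentiable (at z)"
    and dG: "\<And>x y. (\<lambda>p. G p x y) differentiable (at z)"
    and G: "bilinear (G z)"
    and metric: "\<And>x y v. nabla_metric G q z x y v = 0"
  defines "E \<equiv> \<lambda>x y v w. frechet_derivative (\<lambda>p. q p (torsion G p y v) w) (at z) x
      - q z (torsion G z y v) (G z x w)"
  shows "E x y v w + E y v x w + E v x y w =
    q z (curvature G z x y v) w + q z (curvature G z y v x) w + q z (curvature G z v x y) w"
proof -
  define D where "D x y v = frechet_derivative (\<lambda>p. G p y v) (at z) x" for x y v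
  have tor: "torsion G p y v = G p y v - G p v y" for p y v
    by (simp add: torsion_def)
  have curv: "curvature G z x y v = D x y v + G z x (G z y v) - (D y x v + G z y (G z x v))" for x y v
    by (simp add: curvature_def covariant_derivative_along_const D_def)
  have dtor: "((\<lambda>p. torsion G p y v) has_derivative (\<lambda>x. D x y v - D x v y)) (at z)" for y v
    unfolding tor D_def using dG by (intro has_derivative_diff) (simp_all add: frechet_derivative_works)
  have E: "E x y v w = q z (G z x (torsion G z y v)) w + q z (D x y v - D x v y) w" for x y v w
  proof -
    have lin: "linear (\<lambda>a. q p a w)" if "p \<in> V" for p
      using q[OF that] by (simp add: bilinear_def)
    show ?thesis
      unfolding E_def
      using frechet_derivative_linear_apply[OF V lin dq differentiableI[OF dtor], of y v x]
        frechet_derivative_metric[OF metric, of "torsion G z y v" w x]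
        frechet_derivative_at[OF dtor[of y v], THEN fun_cong, of x]
      by simp
  qed
  note L = bilinear_lsub[OF q[OF V(2)]] bilinear_ladd[OF q[OF V(2)]] bilinear_rsub[OF G]
  show ?thesis
    by (simp add: E curv tor L)
qed


section \<open>Vanishing of d\<omega> in a chart\<close>

text \<open>Many hypotheses are stated on all of \<open>V\<close> because the torsion formula
  derived from them is differentiated at \<open>z\<close>.\<close>

lemma skl_lck_chart_kaehler:
  fixes q :: "complex^'n::finite \<Rightarrow> complex^'n \<Rightarrow> complex^'n \<Rightarrow> real"
  assumes n: "CARD('n) \<ge> 3" and V: "open V" "z \<in> V"
    and q: "\<And>p. p \<in> V \<Longrightarrow> hermitian_inner (q p)"
    and dq: "\<And>p x y. p \<in> V \<Longrightarrow> (\<lambda>p. q p x y) differentiable (at p)"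
    and dG: "\<And>x y. (\<lambda>p. G p x y) differentiable (at z)"
    and G: "bilinear (G z)"
    and metric: "\<And>p x y v. p \<in> V \<Longrightarrow> nabla_metric G q p x y v = 0"
    and GJ: "\<And>p x y. p \<in> V \<Longrightarrow> nabla_J G p x y = 0"
    and skew: "\<And>p. p \<in> V \<Longrightarrow> totally_skew (\<lambda>x y v. q p (torsion G p x y) v)"
    and df: "\<And>p. p \<in> V \<Longrightarrow> f differentiable (at p)"
    and ddf: "\<And>x. (\<lambda>p. frechet_derivative f (at p) x) differentiable (at z)"
    and lck: "\<And>p x y v. p \<in> V \<Longrightarrow>
      ext_deriv2 (kaehler_form (\<lambda>p x y. exp (2 * f p) * q p x y)) p x y v = 0"
    and bianchi: "\<And>x y v w. q z (curvature G z x y v) w + q z (curvature G z y v x) w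
        + q z (curvature G z v x y) w = 0"
  shows "ext_deriv2 (kaehler_form q) z x y v = 0"
proof -
  define \<omega> where "\<omega> p = (\<lambda>x y. q p (J x) y)" for p
  \<comment> \<open>Expanding d(e^(2f) \<omega>) = 0 gives d\<omega> = -2 df wedge \<omega>.\<close>
  define \<theta> where "\<theta> p x = - 2 * frechet_derivative f (at p) x" for p x
  define \<alpha> where "\<alpha> p = (\<lambda>x. \<theta> p (J x))" for p
  define D where "D p x y v = frechet_derivative (\<lambda>p. \<omega> p y v) (at p) x" for p x y v
  have d\<omega>: "(\<lambda>p. \<omega> p y v) differentiable (at p)" if "p \<in> V" for p y v
    unfolding \<omega>_def using dq[OF that] .
  have D\<omega>: "((\<lambda>p. \<omega> p y v) has_derivative (\<lambda>x. D p x y v)) (at p)" if "p \<in> V" for p y v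
    using d\<omega>[OF that] unfolding D_def by (simp add: frechet_derivative_works)
  have GJ': "G p x (J y) = J (G p x y)" if "p \<in> V" for p x y
    using GJ[OF that, of x y] by (simp add: nabla_J_def)
  have D: "D p x y v = \<omega> p (G p x y) v + \<omega> p y (G p x v)" if "p \<in> V" for p x y v
    unfolding D_def \<omega>_def frechet_derivative_metric[OF metric[OF that]] GJ'[OF that] ..
  have cyc: "D p x y v + D p y v x + D p v x y = wedge12 (\<theta> p) (\<omega> p) x y v" if p: "p \<in> V" for p x y v
  proof -
    have "((\<lambda>p. exp (2 * f p) * \<omega> p y v) has_derivative
        (\<lambda>x. exp (2 * f p) * (D p x y v - \<theta> p x * \<omega> p y v))) (at p)" for y v
    proof -
      have "(f has_derivative frechet_derivative f (at p)) (at p)"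
        using df[OF p] by (simp add: frechet_derivative_works)
      then show ?thesis
        by (auto intro!: derivative_eq_intros D\<omega>[OF p] simp: \<theta>_def algebra_simps)
    qed
    from frechet_derivative_at[OF this, symmetric]
    have "exp (2 * f p) * ((D p x y v + D p y v x + D p v x y) - wedge12 (\<theta> p) (\<omega> p) x y v) = 0"
      using lck[OF p, of x y v]
      by (simp add: ext_deriv2_def kaehler_form_def \<omega>_def wedge12_def algebra_simps)
    then show ?thesis by simp
  qed
  have T: "q p (torsion G p x y) v = wedge12 (\<alpha> p) (\<omega> p) x y v" if p: "p \<in> V" for p x y v
    unfolding torsion_def covariant_derivative_const \<alpha>_def \<omega>_def
  proof (rule lck_torsion[OF q[OF p]])
    show "G p x (J y) = J (G p x y)" for x y using GJ'[OF p] .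
    show "totally_skew (\<lambda>x y v. q p (G p x y - G p y x) v)"
      using skew[OF p] by (simp add: torsion_def)
  qed (use cyc[OF p] in \<open>simp add: D[OF p] \<omega>_def\<close>)
  note Q = hermitian_innerD[OF q[OF V(2)]]
  have lin\<theta>: "linear (\<theta> z)"
    using linear_compose_scale_right[OF linear_frechet_derivative[OF df[OF V(2)]], of "- 2"]
    by (simp add: \<theta>_def[abs_def])
  have lin\<alpha>: "linear (\<alpha> z)"
    using linear_compose[OF linear_J lin\<theta>] by (simp add: \<alpha>_def o_def)
  define \<alpha>' where "\<alpha>' x y = frechet_derivative (\<lambda>p. \<alpha> p y) (at z) x" for x y
  have D\<alpha>: "((\<lambda>p. \<alpha> p y) has_derivative (\<lambda>x. \<alpha>' x y)) (at z)" for y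
  proof -
    have "(\<lambda>p. \<alpha> p y) differentiable (at z)"
      unfolding \<alpha>_def \<theta>_def by (intro derivative_intros ddf)
    then show ?thesis by (simp add: frechet_derivative_works \<alpha>'_def)
  qed
  \<comment> \<open>The covariant derivative of the 1-form \<alpha> at \<open>z\<close>.\<close>
  define B where "B x y = \<alpha>' x y - \<alpha> z (G z x y)" for x y
  have DT: "frechet_derivative (\<lambda>p. q p (torsion G p y v) w) (at z) x
      = wedge12 (\<alpha>' x) (\<omega> z) y v w + wedge12 (\<alpha> z) (D z x) y v w" for x y v w
  proof -
    note d = D\<omega>[OF V(2)]
    have "((\<lambda>p. wedge12 (\<alpha> p) (\<omega> p) y v w) has_derivative
        (\<lambda>x. wedge12 (\<alpha>' x) (\<omega> z) y v w + wedge12 (\<alpha> z) (D z x) y v w)) (at z)"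
      unfolding wedge12_def
      by (rule has_derivative_eq_rhs[OF has_derivative_add[OF has_derivative_add[OF
            has_derivative_mult[OF D\<alpha> d] has_derivative_mult[OF D\<alpha> d]]
            has_derivative_mult[OF D\<alpha> d]]])
        (simp add: fun_eq_iff)
    then have "((\<lambda>p. q p (torsion G p y v) w) has_derivative
        (\<lambda>x. wedge12 (\<alpha>' x) (\<omega> z) y v w + wedge12 (\<alpha> z) (D z x) y v w)) (at z)"
      by (rule has_derivative_transform_within_open[OF _ V]) (simp add: T)
    from frechet_derivative_at[OF this, THEN fun_cong, of x] show ?thesis by simp
  qed
  have "\<alpha> z = (\<lambda>_. 0)"
  proof (rule bianchi_wedge_imp_zero[OF q[OF V(2)] n lin\<alpha>])
    show "q z (torsion G z x y) v = wedge12 (\<alpha> z) (\<lambda>x y. q z (J x) y) x y v" for x y v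
      using T[OF V(2)] by (simp add: \<omega>_def)
    fix x y v w
    let ?E = "\<lambda>x y v. frechet_derivative (\<lambda>p. q p (torsion G p y v) w) (at z) x
      - q z (torsion G z y v) (G z x w)"
    note L = bilinear_lsub[OF Q(1)] bilinear_rsub[OF Q(1)] linear_diff[OF lin\<alpha>] J_simps
    have \<omega>_anti: "\<omega> z a b = - \<omega> z b a" for a b
      using Q(2)[of "J b" a] Q(5)[of a b] by (simp add: \<omega>_def)
    have swap: "wedge12 (\<alpha> z) (\<omega> z) a b c = - wedge12 (\<alpha> z) (\<omega> z) b a c" for a b c
      using \<omega>_anti[of a b] \<omega>_anti[of a c] \<omega>_anti[of b c] by (simp add: wedge12_def)
    have tor: "wedge12 (\<alpha> z) (\<omega> z) (torsion G z a b) c d =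
        wedge12 (\<alpha> z) (\<omega> z) (G z a b) c d - wedge12 (\<alpha> z) (\<omega> z) (G z b a) c d" for a b c d
      by (simp add: torsion_def wedge12_def \<omega>_def L algebra_simps)
    \<comment> \<open>Covariant product rule with \<omega> parallel: the correction in the slot of
      \<open>w\<close> cancels against the subtracted term, those in the slots of \<open>y\<close>
      and \<open>v\<close> remain.\<close>
    have E: "?E x y v = wedge12 (B x) (\<omega> z) y v w
        + (wedge12 (\<alpha> z) (\<omega> z) (G z x y) v w + wedge12 (\<alpha> z) (\<omega> z) y (G z x v) w)" for x y v
      unfolding DT T[OF V(2)] by (simp add: wedge12_def B_def D[OF V(2)] algebra_simps)
    have "?E x y v + ?E y v x + ?E v x y = 0"
      using first_bianchi_torsion[OF V _ dq[OF V(2)] dG G metric[OF V(2)], of y v w x]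
        bianchi[of x y v w] hermitian_innerD(1)[OF q] by simp
    \<comment> \<open>The six remaining corrections pair off under \<open>swap\<close> into
      differences such as \<open>G z x y - G z y x\<close>, that is, into torsion.\<close>
    then show "wedge12 (B x) (\<lambda>x y. q z (J x) y) y v w + wedge12 (B y) (\<lambda>x y. q z (J x) y) v x w
        + wedge12 (B v) (\<lambda>x y. q z (J x) y) x y w
        + wedge12 (\<alpha> z) (\<lambda>x y. q z (J x) y) (torsion G z x y) v w
        + wedge12 (\<alpha> z) (\<lambda>x y. q z (J x) y) (torsion G z y v) x w
        + wedge12 (\<alpha> z) (\<lambda>x y. q z (J x) y) (torsion G z v x) y w = 0"
      unfolding E tor[unfolded \<omega>_def]
      using swap[of x "G z y v" w] swap[of y "G z v x" w] swap[of v "G z x y" w]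
        swap[of x "G z v y" w] swap[of y "G z x v" w] swap[of v "G z y x" w]
      by (simp add: \<omega>_def)
  qed
  \<comment> \<open>\<open>- J\<close> inverts \<open>J\<close>, so \<theta> is recovered from
    \<alpha>.\<close>
  then have "\<alpha> z (- J x) = 0" for x by simp
  then have "\<theta> z x = 0" for x by (simp add: \<alpha>_def J_simps)
  then show ?thesis
    using cyc[OF V(2), of x y v] by (simp add: wedge12_def ext_deriv2_def kaehler_form_def D_def \<omega>_def)
qed

section \<open>From the atlas to a single chart\<close>

lemma smooth_on_differentiable:
  assumes "smooth_on S f" "z \<in> S"
  shows "f differentiable (at z)" "(\<lambda>p. frechet_derivative f (at p) v) differentiable (at z)"
proof -
  \<comment> \<open>The conformal exponent is needed to second order: \<alpha> already contains its
    first derivative and is differentiated once more.\<close>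
  have "Ck_on (Suc (Suc 0)) f S" using assms(1) unfolding smooth_on_def by blast
  then show "f differentiable (at z)" "(\<lambda>p. frechet_derivative f (at p) v) differentiable (at z)"
    using assms(2) by auto
qed

lemma hermitian_metric_onD:
  assumes "hermitian_metric_on A U g" "c \<in> A" "z \<in> snd c ` (fst c \<inter> U)"
  shows "hermitian_inner (g c z)" "(\<lambda>p. g c p x y) differentiable (at z)"
  using assms smooth_on_differentiable(1)
  unfolding hermitian_metric_on_def hermitian_inner_def by blast+

lemma open_chart_image:
  assumes "is_chart M c" "openin M U"
  shows "open (snd c ` (fst c \<inter> U))"
proof -
  have c: "openin M (fst c)" "open (snd c ` fst c)"
    "homeomorphic_map (subtopology M (fst c)) (top_of_set (snd c ` fst c)) (snd c)"
    using assms(1) by (auto simp: is_chart_def)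
  have "openin (subtopology M (fst c)) (fst c \<inter> U)"
    using openin_subtopology_Int[OF assms(2), of "fst c"] by (simp add: Int_commute)
  then have "openin (top_of_set (snd c ` fst c)) (snd c ` (fst c \<inter> U))"
    using homeomorphic_imp_open_map[OF c(3)] by (auto simp: open_map_def)
  then show ?thesis using c(2) by (simp add: openin_open_eq)
qed

theorem mainTheorem10:
  fixes M :: "'a topology"
    and A :: "('a, 'n::finite) chart set"
    and g :: "('a, 'n) metric"
  assumes "complex_manifold M A"
    and "hermitian_metric_on A (topspace M) g"
    and "strominger_kaehler_like A g"
    and "\<not> kaehler_metric_on A (topspace M) g"
    and "CARD('n) \<ge> 3"
  shows "\<not> locally_conformal_kaehler M A g"
proof
  assume lck: "locally_conformal_kaehler M A g"
  \<comment> \<open>As \<open>g\<close> is Hermitian, failing to be Kaehler means d\<omega> is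
    nonzero at some point of some chart.\<close>
  obtain c z x y v where c: "c \<in> A" and z: "z \<in> snd c ` (fst c \<inter> topspace M)"
    and nz: "ext_deriv2 (kaehler_form (g c)) z x y v \<noteq> 0"
    using assms(2,4) unfolding kaehler_metric_on_def by blast
  obtain p where p: "p \<in> fst c" "p \<in> topspace M" "z = snd c p" using z by blast
  obtain U u where U: "openin M U" "p \<in> U" and u: "smooth_function_on A U u"
    and K: "kaehler_metric_on A U (conformal_change u g)"
    using lck p(2) unfolding locally_conformal_kaehler_def by blast
  obtain \<Gamma> where S: "strominger_connection A g \<Gamma>"
    and KL: "\<forall>z\<in>snd c ` fst c. kaehler_like (\<lambda>x y v w. g c z (curvature (\<Gamma> c) z x y v) w)"
    using assms(3) c unfolding strominger_kaehler_like_def by blast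
  have chart: "is_chart M c" using assms(1) c by (simp add: complex_manifold_def)
  define V where "V = snd c ` (fst c \<inter> U)"
  define f where "f = u \<circ> inv_into (fst c) (snd c)"
  have V: "open V" "z \<in> V"
    using open_chart_image[OF chart U(1)] p U(2) by (auto simp: V_def)
  have inV: "p \<in> snd c ` (fst c \<inter> topspace M)" "p \<in> snd c ` fst c" if "p \<in> V" for p
    using that openin_subset[OF U(1)] by (auto simp: V_def)
  have smf: "smooth_on V f"
    using u c by (simp add: smooth_function_on_def V_def f_def)
  have smG: "smooth_on (snd c ` fst c) (\<lambda>z. \<Gamma> c z x y)" for x y
    using S[unfolded strominger_connection_def is_connection_def, THEN conjunct1, THEN conjunct1] c
    by simp
  have "ext_deriv2 (kaehler_form (g c)) z x y v = 0"
  proof (rule skl_lck_chart_kaehler[OF assms(5) V, where G = "\<Gamma> c" and f = f])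
    show "(\<lambda>p. \<Gamma> c p x y) differentiable (at z)" for x y
      using smooth_on_differentiable(1)[OF smG] inV V(2) by blast
    show "bilinear (\<Gamma> c z)"
      using strominger_connectionD(1)[OF S c] inV V(2) by blast
    show "(\<lambda>p. frechet_derivative f (at p) x) differentiable (at z)" for x
      using smooth_on_differentiable(2)[OF smf V(2)] .
    show "g c z (curvature (\<Gamma> c) z x y v) w + g c z (curvature (\<Gamma> c) z y v x) w
        + g c z (curvature (\<Gamma> c) z v x y) w = 0" for x y v w
      using KL[rule_format, OF inV(2)[OF V(2)]] unfolding kaehler_like_def by blast
  next
    fix p x y v assume p: "p \<in> V"
    note pc = inV[OF p]
    show "hermitian_inner (g c p)" "(\<lambda>p. g c p x y) differentiable (at p)"
      using hermitian_metric_onD[OF assms(2) c pc(1)] by blast+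
    show "nabla_metric (\<Gamma> c) (g c) p x y v = 0" "nabla_J (\<Gamma> c) p x y = 0"
      "totally_skew (\<lambda>x y v. g c p (torsion (\<Gamma> c) p x y) v)"
      using strominger_connectionD(2-4)[OF S c pc(2)] by blast+
    show "f differentiable (at p)"
      using smooth_on_differentiable(1)[OF smf p] .
    show "ext_deriv2 (kaehler_form (\<lambda>p x y. exp (2 * f p) * g c p x y)) p x y v = 0"
      using K c p unfolding kaehler_metric_on_def conformal_change_def V_def f_def comp_def by blast
  qed
  then show False using nz by contradiction
qed

end
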